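(* Let $\varGamma$ be a smooth convex body in $\mathbb{R}^2$. Then there exists a constant $\tau>0$, depending on $\varGamma$ only, such that for every finite set $S$ of points in $\mathbb{R}^2$ with distinct pairwise distances and no three points collinear, if $(a,b),(c,d)\in\varPhi(S,\mathcal{L}_\varGamma)$ are two pairs whose lengths are both at most $\tau$, then the segments $[a,b]$ and $[c,d]$ do not cross.
   Context: A convex body in $\mathbb{R}^2$ is a compact convex set with nonempty interior; it is smooth if through each point of its boundary there is a unique tangent (supporting) line. For $p\in\mathbb{R}^2$, $\varGamma_p=p+\varGamma$ and $\mathcal{L}_\varGamma=\{\varGamma_p: p\in\mathbb{R}^2\}$. The length of a pair $(a,b)$ is the Euclidean distance between $a$ and $b$. For a finite set $S$ of points and a collection $\mathcal{X}$ of ranges, a candidate pair in $S$ with respect to $\mathcal{X}$ is a pair of distinct points of $S$ that is the closest-pair (the pair of minimum Euclidean distance) in $S\cap X$ for some $X\in\mathcal{X}$; $\varPhi(S,\mathcal{X})$ denotes the set of all candidate pairs. Two segments cross if they are not collinear and meet at a point that is interior to both. *)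

theory Defs
  imports "HOL-Analysis.Analysis"
begin

definition convex_body :: "(real^2) set \<Rightarrow> bool" where
  "convex_body K \<longleftrightarrow> compact K \<and> convex K \<and> interior K \<noteq> {}"

(* In the plane, lines are exactly the sets {x. u \<bullet> x = c} with u \<noteq> 0.  The line is
   the set L itself, so uniqueness below does not depend on the scaling of (u, c). *)
definition supporting_line :: "(real^2) set \<Rightarrow> real^2 \<Rightarrow> (real^2) set \<Rightarrow> bool" where
  "supporting_line K p L \<longleftrightarrow>
     p \<in> L \<and> (\<exists>u c. u \<noteq> 0 \<and> L = {x. u \<bullet> x = c} \<and> K \<subseteq> {x. u \<bullet> x \<le> c})"

definition smooth_convex_body :: "(real^2) set \<Rightarrow> bool" where
  "smooth_convex_body K \<longleftrightarrow>
     convex_body K \<and> (\<forall>p\<in>frontier K. \<exists>!L. supporting_line K p L)"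

definition translates :: "(real^2) set \<Rightarrow> (real^2) set set" where
  "translates K = range (\<lambda>p. (\<lambda>x. p + x) ` K)"

definition closest_pair :: "(real^2) set \<Rightarrow> real^2 \<Rightarrow> real^2 \<Rightarrow> bool" where
  "closest_pair A a b \<longleftrightarrow> a \<in> A \<and> b \<in> A \<and> a \<noteq> b \<and>
     (\<forall>x\<in>A. \<forall>y\<in>A. x \<noteq> y \<longrightarrow> dist a b \<le> dist x y)"

(* Each unordered candidate pair is represented by both of its orderings. *)
definition candidate_pairs :: "(real^2) set \<Rightarrow> (real^2) set set \<Rightarrow> ((real^2) \<times> (real^2)) set" where
  "candidate_pairs S \<X> = {(a, b). \<exists>X\<in>\<X>. closest_pair (S \<inter> X) a b}"

definition distinct_pairwise_distances :: "(real^2) set \<Rightarrow> bool" where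
  "distinct_pairwise_distances S \<longleftrightarrow>
     (\<forall>a\<in>S. \<forall>b\<in>S. \<forall>c\<in>S. \<forall>d\<in>S.
        a \<noteq> b \<longrightarrow> c \<noteq> d \<longrightarrow> dist a b = dist c d \<longrightarrow> {a, b} = {c, d})"

definition no_three_collinear :: "(real^2) set \<Rightarrow> bool" where
  "no_three_collinear S \<longleftrightarrow>
     (\<forall>a\<in>S. \<forall>b\<in>S. \<forall>c\<in>S. a \<noteq> b \<longrightarrow> a \<noteq> c \<longrightarrow> b \<noteq> c \<longrightarrow> \<not> collinear {a, b, c})"

(* A point is interior to a segment if it lies on it and is not an endpoint. *)
definition segments_cross :: "real^2 \<Rightarrow> real^2 \<Rightarrow> real^2 \<Rightarrow> real^2 \<Rightarrow> bool" where
  "segments_cross a b c d \<longleftrightarrow>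
     \<not> collinear {a, b, c, d} \<and> open_segment a b \<inter> open_segment c d \<noteq> {}"

end

theory Submission
  imports Defs
begin

text \<open>Let \<open>(a, b)\<close> and \<open>(c, d)\<close> be closest pairs in the translates \<open>X\<close> and \<open>Y\<close>, crossing at \<open>g\<close>.
  If one of \<open>a, b\<close> lies in \<open>Y\<close> and one of \<open>c, d\<close> lies in \<open>X\<close>, two opposite sides of the
  quadrilateral \<open>acbd\<close> are at least as long as its diagonals, against the triangle inequality.
  Otherwise say \<open>c\<close> and \<open>d\<close> lie outside \<open>X\<close>.  Then \<open>cd\<close> cuts a short chord from \<open>X\<close>; let \<open>a\<close> be
  on the side of it not containing the centre of a fixed disc inside \<open>X\<close>.  Convexity alone forces
  \<open>a \<in> Y\<close>.  By smoothness the outer normals of \<open>X\<close> at the two ends of the chord are almost equal,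
  hence almost orthogonal to it, so the cap containing \<open>a\<close> is flat and \<open>a\<close> is closer to \<open>c\<close> than
  \<open>d\<close> is, contradicting the minimality of \<open>(c, d)\<close> in \<open>Y\<close>.\<close>

section \<open>Planar convexity: translating a point of a cap\<close>

text \<open>Coordinates: \<open>c\<close> is the origin, \<open>d = (L, 0)\<close>, \<open>a = (\<alpha>, h)\<close>, and \<open>Y\<close> is the translate of
  \<open>G = X\<close> by \<open>v\<close>.  Long chords of \<open>G\<close> below the axis force \<open>v2 > 0\<close>; the line from \<open>a\<close> in
  direction \<open>- v\<close> then meets the segment from \<open>c - v\<close> to \<open>d - v\<close> beyond \<open>a - v\<close>.\<close>

lemma convex_plane_translate_mem:
  fixes G :: "(real \<times> real) set"
  assumes G: "convex G" and c: "(0, 0) \<notin> G" and d: "(L, 0) \<notin> G"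
    and g: "(g, 0) \<in> G" "0 < g" "g < L"
    and a: "(\<alpha>, h) \<in> G" "0 < h"
    and cv: "(- v1, - v2) \<in> G" and dv: "(L - v1, - v2) \<in> G"
    and mn: "(m, - k) \<in> G" "(m + M, - k) \<in> G" "L \<le> M" "0 \<le> k"
  shows "(\<alpha> - v1, h - v2) \<in> G"
proof -
  have comb: "((1 - t) * x1 + t * y1, (1 - t) * x2 + t * y2) \<in> G"
    if "(x1, x2) \<in> G" "(y1, y2) \<in> G" "0 \<le> t" "t \<le> 1" for x1 x2 y1 y2 t
    using convexD_alt[OF G that] by simp
  have between: "(z, 0) \<in> G" if "(x, 0) \<in> G" "(y, 0) \<in> G" "x \<le> z" "z \<le> y" for x y z
  proof (cases "x = y")
    case False
    define t where "t = (z - x) / (y - x)"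
    have "x < y" using False that by simp
    then have t: "0 \<le> t" "t \<le> 1" "t * (y - x) = z - x" using that by (auto simp: t_def field_simps)
    have "(1 - t) * x + t * y = z" using t(3) by (simp add: algebra_simps)
    then show ?thesis using comb[OF that(1,2) t(1,2)] by simp
  qed (use that in simp)
  \<comment> \<open>The axis meets \<open>G\<close> in an interval containing \<open>g\<close> and
    missing both \<open>0\<close> and \<open>L\<close>.\<close>
  have in_gap: "0 < z \<and> z < L" if "(z, 0) \<in> G" for z
    using between[OF that g(1), of 0] between[OF g(1) that, of L] g c d by fastforce
  have no_long: False if "(z, 0) \<in> G" "(z + l, 0) \<in> G" "L \<le> l" for z l
    using in_gap[OF that(1)] in_gap[OF that(2)] that(3) by linarith
  have "k \<noteq> 0" using no_long[of m M] mn by auto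
  then have k: "0 < k" using mn(4) by simp
  have v2: "0 < v2"
  proof (rule ccontr)
    assume "\<not> 0 < v2"
    \<comment> \<open>This weight brings height \<open>- k\<close> and height \<open>- v2\<close> to
      height 0. Interpolating the two horizontal chords end by end then puts a chord of length at
      least \<open>L\<close> on the axis, which \<open>no_long\<close> excludes.\<close>
    define t where "t = k / (k - v2)"
    have pos: "0 < k - v2" using k \<open>\<not> 0 < v2\<close> by linarith
    have t: "0 \<le> t" "t \<le> 1" using pos k \<open>\<not> 0 < v2\<close> by (auto simp: t_def divide_simps)
    have z: "(1 - t) * (- k) + t * (- v2) = 0" using pos by (simp add: t_def field_simps)
    have "((1 - t) * m + t * (- v1), 0) \<in> G" using comb[OF mn(1) cv t] z by simp
    moreover have "((1 - t) * (m + M) + t * (L - v1), 0) \<in> G" using comb[OF mn(2) dv t] z by simp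
    moreover have "(1 - t) * (m + M) + t * (L - v1) = ((1 - t) * m + t * (- v1)) + (L + (1 - t) * (M - L))"
      by (simp add: algebra_simps)
    moreover have "0 \<le> (1 - t) * (M - L)" using t mn(3) by simp
    ultimately show False using no_long[of _ "L + (1 - t) * (M - L)"] by simp
  qed
  \<comment> \<open>The segments from \<open>a\<close> to \<open>c - v\<close> and to
    \<open>d - v\<close> cross the axis at this weight. Both crossings lie strictly between
    \<open>0\<close> and \<open>L\<close>; cleared of denominators, this says that the line from
    \<open>a\<close> in direction \<open>- v\<close> meets the axis between \<open>c\<close> and
    \<open>d\<close>.\<close>
  define t where "t = h / (h + v2)"
  have t: "0 \<le> t" "t \<le> 1" "0 < t" using a(2) v2 by (auto simp: t_def)
  have z: "(1 - t) * h + t * (- v2) = 0" using a(2) v2 by (simp add: t_def field_simps)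
  have "((1 - t) * \<alpha> + t * (- v1), 0) \<in> G" using comb[OF a(1) cv t(1,2)] z by simp
  from in_gap[OF this] have l: "t * v1 < (1 - t) * \<alpha>" by simp
  have "((1 - t) * \<alpha> + t * (L - v1), 0) \<in> G" using comb[OF a(1) dv t(1,2)] z by simp
  from in_gap[OF this] have r: "(1 - t) * \<alpha> - t * v1 < (1 - t) * L" by (simp add: algebra_simps)
  have t1: "1 - t = v2 / (h + v2)" using a(2) v2 by (simp add: t_def field_simps)
  have pos: "0 < h + v2" using a(2) v2 by simp
  have scaled: "(h + v2) * t = h" "(h + v2) * (1 - t) = v2" using pos unfolding t1 by (auto simp: t_def)
  have l': "v1 * h < \<alpha> * v2"
    using mult_strict_left_mono[OF l pos] unfolding mult.assoc[symmetric] scaled by (simp add: mult.commute)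
  have r': "\<alpha> * v2 - v1 * h < L * v2"
  proof -
    have "v2 * \<alpha> - h * v1 < v2 * L"
      using mult_strict_left_mono[OF r pos]
      unfolding right_diff_distrib[of "h + v2" "(1 - t) * \<alpha>"] mult.assoc[symmetric] scaled .
    then show ?thesis by (simp add: mult.commute)
  qed
  \<comment> \<open>\<open>s\<close> is the relative position of that axis point between
    \<open>c\<close> and \<open>d\<close>. Shifted by \<open>- v\<close>, the point has the same
    position between \<open>c - v\<close> and \<open>d - v\<close>.\<close>
  define s where "s = (\<alpha> * v2 - v1 * h) / (L * v2)"
  have L: "0 < L" using g by simp
  have s: "0 \<le> s" "s \<le> 1" using l' r' L v2 by (auto simp: s_def)
  have foot: "((1 - s) * (- v1) + s * (L - v1), (1 - s) * (- v2) + s * (- v2)) \<in> G"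
    by (rule comb[OF cv dv s])
  have "(1 - s) * (- v1) + s * (L - v1) = \<alpha> - v1 - v1 * h / v2"
    using L v2 by (simp add: s_def field_simps)
  moreover have "(1 - s) * (- v2) + s * (- v2) = - v2" by (simp add: algebra_simps)
  ultimately have foot: "(\<alpha> - v1 - v1 * h / v2, - v2) \<in> G" using foot by simp
  \<comment> \<open>The foot is \<open>a - (1 + h / v2) v\<close>, so the weight
    \<open>1 - t = v2 / (h + v2)\<close> on it yields exactly \<open>a - v\<close>.\<close>
  have u: "0 \<le> 1 - t" "1 - t \<le> 1" using t by auto
  have "(1 - (1 - t)) * \<alpha> + (1 - t) * (\<alpha> - v1 - v1 * h / v2) = \<alpha> - v1"
  proof -
    have "v1 + v1 * h / v2 = v1 * (h + v2) / v2" using v2 by (simp add: field_simps)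
    then have "(1 - t) * (v1 + v1 * h / v2) = v1" using v2 pos unfolding t1 by simp
    then show ?thesis by (simp add: algebra_simps)
  qed
  moreover have "(1 - (1 - t)) * h + (1 - t) * (- v2) = h - v2"
    using scaled by (simp add: algebra_simps)
  ultimately show ?thesis using comb[OF a(1) foot u] by simp
qed

section \<open>Outer unit normals of a smooth convex body\<close>

text \<open>Smoothness gives both normals the same supporting line, so they agree up to sign.
  Opposite signs are impossible because an interior point lies strictly inside both
  half-planes.\<close>

lemma unit_normal_unique:
  fixes K :: "(real^2) set"
  assumes K: "smooth_convex_body K" and x: "x \<in> K"
    and n: "norm n = 1" "\<And>w. w \<in> K \<Longrightarrow> n \<bullet> w \<le> n \<bullet> x"
    and m: "norm m = 1" "\<And>w. w \<in> K \<Longrightarrow> m \<bullet> w \<le> m \<bullet> x"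
  shows "n = m"
proof -
  have nn: "n \<bullet> n = 1" "m \<bullet> m = 1" using n(1) m(1) by (auto simp: norm_eq_1)
  have above: "n \<bullet> p < n \<bullet> x" if p: "p \<in> interior K"
    and n: "norm n = 1" "\<And>w. w \<in> K \<Longrightarrow> n \<bullet> w \<le> n \<bullet> x" for n p
  proof -
    obtain e where e: "e > 0" "cball p e \<subseteq> K" using p by (meson mem_interior_cball)
    have "p + e *\<^sub>R n \<in> K" using e n(1) by (intro subsetD[OF e(2)]) (simp add: dist_norm)
    from n(2)[OF this] have "n \<bullet> p + e * (n \<bullet> n) \<le> n \<bullet> x" by (simp add: inner_simps)
    then show ?thesis using e(1) n(1) by (simp add: norm_eq_1)
  qed
  have "x \<notin> interior K" using above[OF _ n] by blast
  then have fr: "x \<in> frontier K" using x closure_subset by (auto simp: frontier_def)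
  have line: "supporting_line K x {w. n \<bullet> w = n \<bullet> x}"
    if "norm n = 1" "\<And>w. w \<in> K \<Longrightarrow> n \<bullet> w \<le> n \<bullet> x" for n
    unfolding supporting_line_def using that by (auto intro!: exI[of _ n] exI[of _ "n \<bullet> x"])
  have eq: "{w. n \<bullet> w = n \<bullet> x} = {w. m \<bullet> w = m \<bullet> x}"
    using K fr line[OF n] line[OF m] unfolding smooth_convex_body_def by blast
  \<comment> \<open>\<open>y\<close> moves along the line normal to \<open>m\<close> by the part of
    \<open>n\<close> orthogonal to \<open>m\<close>. Since \<open>y\<close> is on the line of
    \<open>n\<close> as well, that part vanishes.\<close>
  define y where "y = x + (n - (n \<bullet> m) *\<^sub>R m)"
  have "m \<bullet> y = m \<bullet> x" by (simp add: y_def inner_simps nn inner_commute)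
  then have "n \<bullet> y = n \<bullet> x" using eq by blast
  then have "(n \<bullet> m)\<^sup>2 = 1" by (simp add: y_def inner_simps nn power2_eq_square)
  then consider "n \<bullet> m = 1" | "n \<bullet> m = - 1" by (auto simp: power2_eq_1_iff)
  then show ?thesis
  proof cases
    case 1
    have "(n - m) \<bullet> (n - m) = 0" using 1 nn by (simp add: inner_simps inner_commute)
    then show ?thesis by simp
  next
    case 2
    have "(n + m) \<bullet> (n + m) = 0" using 2 nn by (simp add: inner_simps inner_commute)
    then have "m = - n" by (simp add: eq_neg_iff_add_eq_0 add.commute)
    moreover obtain p where "p \<in> interior K"
      using K unfolding smooth_convex_body_def convex_body_def by blast
    ultimately show ?thesis using above[OF _ n, of p] above[OF _ m, of p] by simp
  qed
qed

text \<open>By uniqueness the graph of the outer unit normal is compact, which makes the normal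
  a uniformly continuous function of the boundary point.\<close>

lemma unit_normal_uniformly_continuous:
  fixes K :: "(real^2) set"
  assumes K: "smooth_convex_body K" and "0 < \<epsilon>"
  shows "\<exists>\<delta>>0. \<forall>x\<in>K. \<forall>y\<in>K. \<forall>n m. norm n = 1 \<longrightarrow> norm m = 1 \<longrightarrow>
    (\<forall>w\<in>K. n \<bullet> w \<le> n \<bullet> x) \<longrightarrow> (\<forall>w\<in>K. m \<bullet> w \<le> m \<bullet> y) \<longrightarrow> dist x y < \<delta> \<longrightarrow> dist n m < \<epsilon>"
proof -
  have cK: "compact K" using K by (auto simp: smooth_convex_body_def convex_body_def)
  define P where "P = {(x, n). x \<in> K \<and> norm n = 1 \<and> (\<forall>w\<in>K. n \<bullet> w \<le> n \<bullet> x)}"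
  have P_eq: "P = (K \<times> sphere 0 1) \<inter> (\<Inter>w\<in>K. {z. snd z \<bullet> w \<le> snd z \<bullet> fst z})"
    by (auto simp: P_def)
  have "closed (\<Inter>w\<in>K. {z :: (real^2) \<times> (real^2). snd z \<bullet> w \<le> snd z \<bullet> fst z})"
    by (intro closed_INT ballI closed_Collect_le continuous_intros)
  then have P: "compact P" unfolding P_eq
    by (intro compact_Int_closed compact_Times cK compact_sphere)
  \<comment> \<open>\<open>N\<close> is the normal map read off from the graph \<open>P\<close>. It
    is used only on the first projection of \<open>P\<close>, where uniqueness determines its
    value.\<close>
  define N where "N x = (THE n. (x, n) \<in> P)" for x
  have N: "N x = n" if "(x, n) \<in> P" for x n
    unfolding N_def using that unit_normal_unique[OF K] by (intro the_equality) (auto simp: P_def)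
  have graph: "(\<lambda>x. (x, N x)) ` fst ` P = P" using N by force
  have cF: "compact (fst ` P)" by (intro compact_continuous_image P continuous_intros)
  \<comment> \<open>A map into a compact space with closed graph is continuous; compactness of the
    domain then makes it uniformly continuous.\<close>
  have "continuous_on (fst ` P) N"
  proof (rule continuous_from_closed_graph)
    show "compact (sphere (0 :: real^2) 1)" by simp
    show "N \<in> fst ` P \<rightarrow> sphere 0 1" using N by (force simp: P_def)
    show "closed ((\<lambda>x. (x, N x)) ` fst ` P)" unfolding graph by (rule compact_imp_closed[OF P])
  qed
  from compact_uniformly_continuous[OF this cF] \<open>0 < \<epsilon>\<close>
  obtain \<delta> where \<delta>: "\<delta> > 0"
    "\<And>x y. x \<in> fst ` P \<Longrightarrow> y \<in> fst ` P \<Longrightarrow> dist y x < \<delta> \<Longrightarrow> dist (N y) (N x) < \<epsilon>"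
    unfolding uniformly_continuous_on_def by metis
  have "dist n m < \<epsilon>" if "(x, n) \<in> P" "(y, m) \<in> P" "dist x y < \<delta>" for x y n m
    using \<delta>(2)[of y x] that N by (metis fst_conv image_eqI)
  then show ?thesis using \<delta>(1) by (intro exI[of _ \<delta>]) (auto simp: P_def)
qed

section \<open>Caps cut off by short chords\<close>

text \<open>Let \<open>x\<close> be the point of \<open>K\<close> on the segment that is nearest to
  \<open>c\<close>. The open segment from \<open>c\<close> to \<open>x\<close> misses
  \<open>K\<close>, and a line separating the two supplies the normal at \<open>x\<close>.\<close>

lemma exists_exit_normal:
  fixes K :: "'a::euclidean_space set"
  assumes K: "compact K" "convex K" and g: "g \<in> K" and c: "c \<notin> K"
  shows "\<exists>x n. x \<in> K \<and> x \<in> closed_segment c g \<and> norm n = 1 \<and> (\<forall>w\<in>K. n \<bullet> w \<le> n \<bullet> x) \<and> n \<bullet> x \<le> n \<bullet> c"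
proof -
  have "compact (K \<inter> closed_segment c g)" "K \<inter> closed_segment c g \<noteq> {}"
    using K g by auto
  then obtain x where x: "x \<in> K" "x \<in> closed_segment c g"
    and min: "\<And>y. y \<in> K \<inter> closed_segment c g \<Longrightarrow> dist c x \<le> dist c y"
    using distance_attains_inf[of "K \<inter> closed_segment c g" c] by (auto simp: compact_imp_closed)
  have "x \<noteq> c" using x c by blast
  have "open_segment c x \<inter> K = {}"
  proof (rule ccontr)
    assume "open_segment c x \<inter> K \<noteq> {}"
    then obtain y where y: "y \<in> open_segment c x" "y \<in> K" by blast
    have "y \<in> closed_segment c g"
      using y(1) x(2) by (meson ends_in_segment(1) open_closed_segment subset_closed_segment subsetD)
    with min y have "dist c x \<le> dist c y" by blast
    with dist_in_open_segment[OF y(1)] show False by (simp add: dist_commute)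
  qed
  moreover have "convex (open_segment c x)" "open_segment c x \<noteq> {}" "K \<noteq> {}"
    using \<open>x \<noteq> c\<close> x by auto
  ultimately obtain n b where n: "n \<noteq> 0" "\<And>w. w \<in> K \<Longrightarrow> n \<bullet> w \<le> b"
    "\<And>w. w \<in> open_segment c x \<Longrightarrow> b \<le> n \<bullet> w"
    using separating_hyperplane_sets[of K "open_segment c x"] K(2) by blast
  have "closed {w. b \<le> n \<bullet> w}" by (simp add: closed_halfspace_ge)
  \<comment> \<open>The closure brings in the ends \<open>c\<close> and \<open>x\<close>. As
    \<open>x\<close> is also in \<open>K\<close>, the separating line passes through
    \<open>x\<close>.\<close>
  then have "closure (open_segment c x) \<subseteq> {w. b \<le> n \<bullet> w}"
    using n(3) by (intro closure_minimal) auto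
  then have cx: "b \<le> n \<bullet> c" "b \<le> n \<bullet> x" using \<open>x \<noteq> c\<close> by (auto simp: closure_open_segment)
  then have b: "n \<bullet> x = b" using n(2)[OF x(1)] by simp
  define n' where "n' = (1 / norm n) *\<^sub>R n"
  have "norm n' = 1" using n(1) by (simp add: n'_def)
  moreover have "n' \<bullet> w \<le> n' \<bullet> x" if "w \<in> K" for w
    using n(2)[OF that] b n(1) by (simp add: n'_def divide_right_mono)
  moreover have "n' \<bullet> x \<le> n' \<bullet> c"
    using cx(1) b n(1) by (simp add: n'_def divide_right_mono)
  ultimately show ?thesis using x by blast
qed

lemma orthonormal_expansion:
  fixes e f w :: "real^2"
  assumes "norm e = 1" "norm f = 1" "e \<bullet> f = 0"
  shows "w = (w \<bullet> e) *\<^sub>R e + (w \<bullet> f) *\<^sub>R f"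
    and "w \<bullet> w = (w \<bullet> e)\<^sup>2 + (w \<bullet> f)\<^sup>2"
proof -
  have ee: "e \<bullet> e = 1" "f \<bullet> f = 1" using assms by (auto simp: norm_eq_1)
  have "(e$1)\<^sup>2 + (e$2)\<^sup>2 = 1" "(f$1)\<^sup>2 + (f$2)\<^sup>2 = 1" "e$1 * f$1 + e$2 * f$2 = 0"
    using ee assms(3) by (auto simp: inner_vec_def sum_2 power2_eq_square)
  \<comment> \<open>A square matrix with orthonormal rows has orthonormal columns.\<close>
  then have "(e$1)\<^sup>2 + (f$1)\<^sup>2 = 1" "(e$2)\<^sup>2 + (f$2)\<^sup>2 = 1" "e$1 * e$2 + f$1 * f$2 = 0"
    by algebra+
  then show 1: "w = (w \<bullet> e) *\<^sub>R e + (w \<bullet> f) *\<^sub>R f"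
    unfolding vec_eq_iff forall_2 by (simp add: inner_vec_def sum_2) algebra
  have "w \<bullet> w = w \<bullet> ((w \<bullet> e) *\<^sub>R e + (w \<bullet> f) *\<^sub>R f)" using 1 by simp
  then show "w \<bullet> w = (w \<bullet> e)\<^sup>2 + (w \<bullet> f)\<^sup>2" by (simp add: inner_simps power2_eq_square)
qed

text \<open>The normals at the two ends of the chord tilt away from each other along
  \<open>cd\<close> but are almost equal, so both are nearly orthogonal to \<open>cd\<close>. The
  disc forces them to point to the side of \<open>a\<close>. Hence the cap lies below the lines of
  slope 1 through \<open>c\<close> and slope -1 through \<open>d\<close>, and each of its points is
  closer to \<open>c\<close> than \<open>d\<close> is.\<close>

lemma cap_point_close:
  fixes K :: "(real^2) set"
  assumes K: "compact K" "convex K" and ball: "cball o' r \<subseteq> K" "0 < r"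
    and D: "\<And>x. x \<in> K \<Longrightarrow> norm (o' - x) \<le> D"
    and \<epsilon>: "0 < \<epsilon>" "\<epsilon> \<le> 1/2" "\<epsilon> * D < r"
    and normals: "\<And>x y n m. x \<in> K \<Longrightarrow> y \<in> K \<Longrightarrow> norm n = 1 \<Longrightarrow> norm m = 1 \<Longrightarrow>
      (\<And>w. w \<in> K \<Longrightarrow> n \<bullet> w \<le> n \<bullet> x) \<Longrightarrow> (\<And>w. w \<in> K \<Longrightarrow> m \<bullet> w \<le> m \<bullet> y) \<Longrightarrow>
      dist x y \<le> dist c d \<Longrightarrow> dist n m < \<epsilon>"
    and cd: "c \<notin> K" "d \<notin> K" and g: "g \<in> K" "g \<in> open_segment c d" and a: "a \<in> K"
    and f: "norm f = 1" "f \<bullet> (d - c) = 0" "f \<bullet> (o' - c) \<le> 0" "0 < f \<bullet> (a - c)"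
  shows "dist a c < dist c d"
proof -
  define L where "L = dist c d"
  define e where "e = (1 / L) *\<^sub>R (d - c)"
  have "c \<noteq> d" using g(2) by auto
  then have L: "0 < L" by (simp add: L_def)
  have dc: "d - c = L *\<^sub>R e" using L by (simp add: e_def)
  have e1: "norm e = 1" using L by (simp add: e_def L_def dist_norm norm_minus_commute)
  have ef: "e \<bullet> f = 0" using f(2) by (simp add: e_def inner_commute)
  note expand = orthonormal_expansion[OF e1 f(1) ef]
  have ee: "e \<bullet> e = 1" "f \<bullet> f = 1" using e1 f(1) by (auto simp: norm_eq_1)
  have inner2: "n \<bullet> w = (n \<bullet> e) * (w \<bullet> e) + (n \<bullet> f) * (w \<bullet> f)" for n w
  proof -
    have "n \<bullet> w = n \<bullet> ((w \<bullet> e) *\<^sub>R e + (w \<bullet> f) *\<^sub>R f)" using expand(1)[of w] by simp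
    then show ?thesis by (simp add: inner_simps mult.commute)
  qed
  obtain x n where x: "x \<in> K" "x \<in> closed_segment c g" and n: "norm n = 1"
    "\<And>w. w \<in> K \<Longrightarrow> n \<bullet> w \<le> n \<bullet> x" "n \<bullet> x \<le> n \<bullet> c"
    using exists_exit_normal[OF K g(1) cd(1)] by blast
  obtain y m where y: "y \<in> K" "y \<in> closed_segment d g" and m: "norm m = 1"
    "\<And>w. w \<in> K \<Longrightarrow> m \<bullet> w \<le> m \<bullet> y" "m \<bullet> y \<le> m \<bullet> d"
    using exists_exit_normal[OF K g(1) cd(2)] by blast
  have gs: "g \<in> closed_segment c d" using g(2) by (simp add: open_segment_def)
  have "x \<in> closed_segment c d" "y \<in> closed_segment c d"
    using x(2) y(2) gs by (meson ends_in_segment subset_closed_segment subsetD)+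
  then have "dist x y \<le> dist c d"
    using closed_segment_subset[of c "cball y (dist c d)" d] dist_in_closed_segment[of y c d]
    by (auto simp: dist_commute)
  then have nm: "dist n m < \<epsilon>" using normals[OF x(1) y(1) n(1) m(1) n(2) m(2)] by blast
  \<comment> \<open>Since \<open>n \<bullet> e \<le> 0 \<le> m \<bullet> e\<close>, as shown next,
    this bound on the difference also bounds each term.\<close>
  have p_bound: "\<bar>n \<bullet> e - m \<bullet> e\<bar> < \<epsilon>"
  proof -
    have "\<bar>(n - m) \<bullet> e\<bar> \<le> norm (n - m) * norm e" by (rule Cauchy_Schwarz_ineq2)
    then show ?thesis using nm e1 by (simp add: dist_norm inner_simps)
  qed
  have gc: "\<exists>t. 0 < t \<and> t < 1 \<and> g = c + t *\<^sub>R (d - c)"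
    using g(2) by (auto simp: in_segment algebra_simps)
  have ng: "n \<bullet> e \<le> 0"
  proof -
    obtain t where t: "0 < t" "t < 1" "g = c + (t * L) *\<^sub>R e" using gc dc by auto
    have "n \<bullet> g \<le> n \<bullet> c" using n(2)[OF g(1)] n(3) by simp
    then have "(t * L) * (n \<bullet> e) \<le> 0" using t(3) by (simp add: inner_simps)
    then show ?thesis using t L by (simp add: mult_le_0_iff)
  qed
  have mg: "0 \<le> m \<bullet> e"
  proof -
    obtain t where t: "0 < t" "t < 1" "g = c + (t * L) *\<^sub>R e" using gc dc by auto
    have d: "d = c + L *\<^sub>R e" using dc by (simp add: algebra_simps)
    have "m \<bullet> g \<le> m \<bullet> d" using m(2)[OF g(1)] m(3) by simp
    then have "0 \<le> ((1 - t) * L) * (m \<bullet> e)" using t(3) d by (simp add: inner_simps algebra_simps)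
    moreover have "0 < (1 - t) * L" using t L by simp
    ultimately show ?thesis by (simp only: zero_le_mult_iff) linarith
  qed
  have up: "0 < n \<bullet> f \<and> \<bar>n \<bullet> e\<bar> \<le> n \<bullet> f"
    if n: "norm n = 1" "\<bar>n \<bullet> e\<bar> < \<epsilon>" and x: "x \<in> K" "x \<bullet> f = c \<bullet> f"
      and sup: "\<And>w. w \<in> K \<Longrightarrow> n \<bullet> w \<le> n \<bullet> x" for n x
  proof -
    \<comment> \<open>The disc point furthest in direction \<open>n\<close> gives
      \<open>n \<bullet> (o' - x) \<le> - r\<close>. The component along \<open>e\<close> accounts
      for at most \<open>\<epsilon> * D < r\<close>, so the component along \<open>f\<close> is
      negative, and \<open>n \<bullet> f\<close> is positive because \<open>o'\<close> is not above
      the chord.\<close>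
    have "o' + r *\<^sub>R n \<in> K" using ball n by (intro subsetD[OF ball(1)]) (simp add: dist_norm)
    from sup[OF this] have "n \<bullet> (o' - x) \<le> - r" using n(1) by (simp add: inner_simps norm_eq_1)
    then have 1: "(n \<bullet> e) * ((o' - x) \<bullet> e) + (n \<bullet> f) * ((o' - x) \<bullet> f) \<le> - r"
      using inner2[of n "o' - x"] by simp
    have "\<bar>(o' - x) \<bullet> e\<bar> \<le> D" using D[OF x(1)] Cauchy_Schwarz_ineq2[of "o' - x" e] e1 by simp
    then have "\<bar>(n \<bullet> e) * ((o' - x) \<bullet> e)\<bar> \<le> \<epsilon> * D"
      unfolding abs_mult using n(2) \<epsilon>(1) by (intro mult_mono) auto
    then have "(n \<bullet> f) * ((o' - x) \<bullet> f) < 0" using 1 \<epsilon>(3) by linarith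
    moreover have "(o' - x) \<bullet> f \<le> 0" using f(3) x(2) by (simp add: inner_simps inner_commute)
    ultimately have q: "0 < n \<bullet> f" by (simp add: mult_less_0_iff)
    have "(n \<bullet> e)\<^sup>2 + (n \<bullet> f)\<^sup>2 = 1" using expand(2)[of n] n(1) by (simp add: norm_eq_1)
    moreover have "(n \<bullet> e)\<^sup>2 \<le> (1/2)\<^sup>2"
      using n(2) \<epsilon>(2) by (intro abs_le_square_iff[THEN iffD1]) auto
    ultimately have "(n \<bullet> e)\<^sup>2 \<le> (n \<bullet> f)\<^sup>2" by (simp add: power2_eq_square)
    then show ?thesis using q abs_le_square_iff[of "n \<bullet> e" "n \<bullet> f"] by simp
  qed
  have level: "w \<bullet> f = c \<bullet> f" if w: "w \<in> closed_segment c d" for w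
  proof -
    obtain t where "w = (1 - t) *\<^sub>R c + t *\<^sub>R d" using w by (auto simp: in_segment)
    then have "w = c + t *\<^sub>R (d - c)" by (simp add: algebra_simps)
    then show ?thesis using f(2) by (simp add: inner_simps inner_commute)
  qed
  have un: "0 < n \<bullet> f" "\<bar>n \<bullet> e\<bar> \<le> n \<bullet> f"
    using up[OF n(1) _ x(1) level n(2)] p_bound ng mg \<open>x \<in> closed_segment c d\<close> by auto
  have um: "0 < m \<bullet> f" "\<bar>m \<bullet> e\<bar> \<le> m \<bullet> f"
    using up[OF m(1) _ y(1) level m(2)] p_bound ng mg \<open>y \<in> closed_segment c d\<close> by auto
  define \<alpha> where "\<alpha> = (a - c) \<bullet> e"
  define h where "h = (a - c) \<bullet> f"
  have h: "0 < h" using f(4) by (simp add: h_def inner_commute)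
  have "n \<bullet> (a - c) \<le> 0" using n(2)[OF a] n(3) by (simp add: inner_simps)
  then have 1: "(n \<bullet> f) * h \<le> (- (n \<bullet> e)) * \<alpha>" using inner2[of n "a - c"] by (simp add: \<alpha>_def h_def)
  have "m \<bullet> (a - c) \<le> m \<bullet> (d - c)" using m(2)[OF a] m(3) by (simp add: inner_simps)
  then have 2: "(m \<bullet> f) * h \<le> (m \<bullet> e) * (L - \<alpha>)"
    using inner2[of m "a - c"] dc by (simp add: \<alpha>_def h_def algebra_simps)
  have bound: "h \<le> s" if "0 < q" "0 \<le> p" "p \<le> q" "q * h \<le> p * s" for p q s :: real
  proof -
    have "0 < p * s" using mult_pos_pos[OF that(1) h] that(4) by linarith
    then have "0 < s" using that by (simp add: zero_less_mult_iff)
    then have "p * s \<le> q * s" using that by (intro mult_right_mono) auto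
    then have "q * h \<le> q * s" using that by linarith
    then show ?thesis using that by simp
  qed
  have "h \<le> \<alpha>" using bound[OF un(1) _ _ 1] un(2) ng by auto
  moreover have "h \<le> L - \<alpha>" using bound[OF um(1) _ _ 2] um(2) mg by auto
  ultimately have *: "0 < \<alpha>" "h \<le> L - \<alpha>" "0 < L - \<alpha>" using h by auto
  \<comment> \<open>With \<open>h \<le> L - \<alpha>\<close>, the sum
    \<open>\<alpha>\<^sup>2 + h\<^sup>2\<close> is at most
    \<open>L\<^sup>2 - 2 * \<alpha> * (L - \<alpha>)\<close>.\<close>
  have "h\<^sup>2 \<le> (L - \<alpha>)\<^sup>2" using * h by (intro power_mono) auto
  moreover have "0 < \<alpha> * (L - \<alpha>)" using * by simp
  ultimately have "\<alpha>\<^sup>2 + h\<^sup>2 < L\<^sup>2" by (simp add: power2_eq_square algebra_simps)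
  moreover have "(dist a c)\<^sup>2 = \<alpha>\<^sup>2 + h\<^sup>2"
    using expand(2)[of "a - c"] by (simp add: dist_norm power2_norm_eq_inner \<alpha>_def h_def)
  ultimately have "(dist a c)\<^sup>2 < L\<^sup>2" by simp
  then show ?thesis using L power2_less_imp_less[of "dist a c" L] by (simp add: L_def)
qed

text \<open>This transports the coordinate statement \<open>convex_plane_translate_mem\<close> to
  \<open>K\<close>, with origin \<open>c\<close> and orthonormal axes \<open>e\<close> along
  \<open>cd\<close> and \<open>f\<close> towards \<open>a\<close>.\<close>

lemma cap_point_mem_translate:
  fixes K :: "(real^2) set"
  assumes K: "convex K" and ball: "cball o' r \<subseteq> K" "0 < r" and short: "dist c d \<le> 2 * r"
    and cd: "c \<notin> K" "d \<notin> K" and g: "g \<in> K" "g \<in> open_segment c d" and a: "a \<in> K"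
    and f: "norm f = 1" "f \<bullet> (d - c) = 0" "f \<bullet> (o' - c) \<le> 0" "0 < f \<bullet> (a - c)"
    and v: "c - v \<in> K" "d - v \<in> K"
  shows "a - v \<in> K"
proof -
  define L where "L = dist c d"
  define e where "e = (1 / L) *\<^sub>R (d - c)"
  have "c \<noteq> d" using g(2) by auto
  then have L: "0 < L" by (simp add: L_def)
  have dc: "d = c + L *\<^sub>R e" using L by (simp add: e_def)
  have e1: "norm e = 1" using L by (simp add: e_def L_def dist_norm norm_minus_commute)
  have ef: "e \<bullet> f = 0" using f(2) by (simp add: e_def inner_commute)
  note expand = orthonormal_expansion(1)[OF e1 f(1) ef]
  define \<phi> where "\<phi> s t = c + s *\<^sub>R e + t *\<^sub>R f" for s t
  define G where "G = {(s, t). \<phi> s t \<in> K}"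
  have coord: "w = \<phi> ((w - c) \<bullet> e) ((w - c) \<bullet> f)" for w
    using expand[of "w - c"] by (simp add: \<phi>_def algebra_simps)
  have "convex G"
  proof (unfold convex_alt, intro ballI allI impI, safe)
    fix s t s' t' u :: real
    assume "(s, t) \<in> G" "(s', t') \<in> G" "0 \<le> u" "u \<le> 1"
    then have "(1 - u) *\<^sub>R \<phi> s t + u *\<^sub>R \<phi> s' t' \<in> K"
      using convexD_alt[OF K] by (auto simp: G_def)
    moreover have "(1 - u) *\<^sub>R \<phi> s t + u *\<^sub>R \<phi> s' t' = \<phi> ((1 - u) * s + u * s') ((1 - u) * t + u * t')"
      by (simp add: \<phi>_def algebra_simps)
    ultimately show "(1 - u) *\<^sub>R (s, t) + u *\<^sub>R (s', t') \<in> G" by (simp add: G_def)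
  qed
  moreover have "(0, 0) \<notin> G" "(L, 0) \<notin> G" using cd dc by (auto simp: G_def \<phi>_def)
  moreover obtain t where t: "0 < t" "t < 1" "g = c + (t * L) *\<^sub>R e"
    using g(2) dc by (auto simp: in_segment algebra_simps)
  moreover have "(t * L, 0) \<in> G" "0 < t * L" "t * L < L" using t g(1) L by (auto simp: G_def \<phi>_def)
  moreover have "((a - c) \<bullet> e, (a - c) \<bullet> f) \<in> G" "0 < (a - c) \<bullet> f"
    using a coord[of a] f(4) by (auto simp: G_def inner_commute)
  moreover have "(- (v \<bullet> e), - (v \<bullet> f)) \<in> G" "(L - v \<bullet> e, - (v \<bullet> f)) \<in> G"
  proof -
    have "\<phi> (- (v \<bullet> e)) (- (v \<bullet> f)) = c - v" using expand[of v] by (simp add: \<phi>_def algebra_simps)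
    moreover have "\<phi> (L - v \<bullet> e) (- (v \<bullet> f)) = d - v"
      using expand[of v] dc by (simp add: \<phi>_def algebra_simps)
    ultimately show "(- (v \<bullet> e), - (v \<bullet> f)) \<in> G" "(L - v \<bullet> e, - (v \<bullet> f)) \<in> G"
      using v by (auto simp: G_def)
  qed
  \<comment> \<open>The long chord required below the axis is the diameter of the disc parallel to
    \<open>cd\<close>, of length \<open>2 * r\<close>. The double minus sign matches the height
    \<open>- k\<close>.\<close>
  moreover have "((o' - c) \<bullet> e - r, - (- ((o' - c) \<bullet> f))) \<in> G"
    "((o' - c) \<bullet> e - r + 2 * r, - (- ((o' - c) \<bullet> f))) \<in> G"
  proof -
    have "\<phi> ((o' - c) \<bullet> e - r) ((o' - c) \<bullet> f) = o' - r *\<^sub>R e"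
      "\<phi> ((o' - c) \<bullet> e + r) ((o' - c) \<bullet> f) = o' + r *\<^sub>R e"
      using coord[of o'] by (simp_all add: \<phi>_def algebra_simps)
    moreover have "o' - r *\<^sub>R e \<in> K" "o' + r *\<^sub>R e \<in> K"
      using ball e1 by (auto intro!: subsetD[OF ball(1)] simp: dist_norm)
    moreover have "(o' - c) \<bullet> e - r + 2 * r = (o' - c) \<bullet> e + r" by simp
    ultimately show "((o' - c) \<bullet> e - r, - (- ((o' - c) \<bullet> f))) \<in> G"
      "((o' - c) \<bullet> e - r + 2 * r, - (- ((o' - c) \<bullet> f))) \<in> G"
      by (auto simp only: G_def minus_minus mem_Collect_eq case_prod_conv)
  qed
  moreover have "L \<le> 2 * r" "0 \<le> - ((o' - c) \<bullet> f)"
    using short f(3) by (auto simp: L_def inner_commute)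
  ultimately have "((a - c) \<bullet> e - v \<bullet> e, (a - c) \<bullet> f - v \<bullet> f) \<in> G"
    by (intro convex_plane_translate_mem[of G L "t * L" _ _ "v \<bullet> e" "v \<bullet> f"])
  moreover have "\<phi> ((a - c) \<bullet> e - v \<bullet> e) ((a - c) \<bullet> f - v \<bullet> f) = a - v"
    using coord[of "a - v"] by (simp add: inner_simps algebra_simps)
  ultimately show ?thesis by (simp add: G_def)
qed

section \<open>Crossing segments and strict triangle inequalities\<close>

lemma closed_segment_extend:
  fixes a :: "'a::real_vector"
  assumes "g \<in> closed_segment a b" "g \<noteq> a"
  shows "\<exists>k. b = g + k *\<^sub>R (a - g)"
proof -
  obtain t where t: "g = (1 - t) *\<^sub>R a + t *\<^sub>R b" using assms(1) by (auto simp: in_segment)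
  then have "t \<noteq> 0" using assms(2) by auto
  have "t *\<^sub>R (b - g) = (t - 1) *\<^sub>R (a - g)" using t by (simp add: algebra_simps)
  then have "(1 / t) *\<^sub>R t *\<^sub>R (b - g) = (1 / t) *\<^sub>R (t - 1) *\<^sub>R (a - g)" by simp
  then have "b - g = ((t - 1) / t) *\<^sub>R (a - g)" using \<open>t \<noteq> 0\<close> by simp
  then have "b = g + ((t - 1) / t) *\<^sub>R (a - g)" by (simp only: diff_eq_eq add.commute)
  then show ?thesis by blast
qed

text \<open>Every point lies on the line through \<open>g\<close> in direction \<open>a - g\<close>:
  \<open>b\<close> and \<open>d\<close> directly, \<open>c\<close> by way of
  \<open>d\<close>.\<close>

lemma collinear_of_corner:
  fixes a :: "'a::real_vector"
  assumes g: "g \<in> open_segment a b" "g \<in> open_segment c d" and "g \<in> closed_segment a d \<or> a = d"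
  shows "collinear {a, b, c, d}"
proof -
  have ga: "g \<noteq> a" "g \<in> closed_segment a b" "g \<noteq> d" "g \<in> closed_segment d c"
    using g by (auto simp: open_segment_def closed_segment_commute)
  have "\<exists>k. d = g + k *\<^sub>R (a - g)" using assms(3)
  proof
    assume "a = d"
    then show ?thesis by (intro exI[of _ 1]) simp
  qed (use ga(1) closed_segment_extend in blast)
  then obtain k l m where d: "d = g + k *\<^sub>R (a - g)" and b: "b = g + l *\<^sub>R (a - g)"
    and "c = g + m *\<^sub>R (d - g)"
    using closed_segment_extend[OF ga(2,1)] closed_segment_extend[OF ga(4,3)] by blast
  then have "c = g + (m * k) *\<^sub>R (a - g)" "a = g + 1 *\<^sub>R (a - g)" by auto
  with d b show ?thesis unfolding collinear_alt by blast
qed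

text \<open>Equality in the triangle inequality would put \<open>g\<close> on the segment from
  \<open>a\<close> to \<open>d\<close>, which makes all four points collinear.\<close>

lemma crossing_side_less:
  fixes a :: "'a::euclidean_space"
  assumes g: "g \<in> open_segment a b" "g \<in> open_segment c d" and nc: "\<not> collinear {a, b, c, d}"
  shows "a \<noteq> d" "dist a d < dist a g + dist g d"
proof -
  show "dist a d < dist a g + dist g d"
  proof (rule ccontr)
    assume "\<not> dist a d < dist a g + dist g d"
    then have "dist a d = dist a g + dist g d" using dist_triangle[of a d g] by simp
    then have "g \<in> closed_segment a d" by (simp add: between between_mem_segment[symmetric])
    with collinear_of_corner[OF g] nc show False by blast
  qed
qed (use collinear_of_corner[OF g] nc in blast)

section \<open>A uniform length bound for a pair outside the body\<close>

lemma exists_unit_normal_to: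
  fixes z :: "real^2"
  assumes "z \<noteq> 0"
  shows "\<exists>f. norm f = 1 \<and> f \<bullet> z = 0"
proof -
  define f :: "real^2" where "f = vector [- z$2, z$1]"
  have "f \<bullet> z = 0" "f \<bullet> f = z \<bullet> z" by (auto simp: f_def inner_vec_def sum_2)
  then have "norm f = norm z" "f \<bullet> z = 0" by (auto simp: norm_eq)
  then show ?thesis using \<open>z \<noteq> 0\<close> by (intro exI[of _ "(1 / norm z) *\<^sub>R f"]) auto
qed

text \<open>The point \<open>w\<close> is the end of \<open>ab\<close> on the side of the line
  \<open>cd\<close> away from the disc centre \<open>o'\<close>; both cap lemmas apply to
  it.\<close>

lemma short_crossing_outside:
  fixes K :: "(real^2) set"
  assumes K: "smooth_convex_body K"
  shows "\<exists>\<tau>>0. \<forall>a b c d g v. a \<in> K \<longrightarrow> b \<in> K \<longrightarrow> c \<notin> K \<longrightarrow> d \<notin> K \<longrightarrow> c - v \<in> K \<longrightarrow> d - v \<in> K \<longrightarrow>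
    g \<in> open_segment a b \<longrightarrow> g \<in> open_segment c d \<longrightarrow> \<not> collinear {a, b, c, d} \<longrightarrow> dist c d \<le> \<tau> \<longrightarrow>
    (\<exists>w\<in>{a, b}. w - v \<in> K \<and> dist w c < dist c d)"
proof -
  have cK: "compact K" "convex K" and "interior K \<noteq> {}"
    using K by (auto simp: smooth_convex_body_def convex_body_def)
  then obtain o' r where ball: "0 < r" "cball o' r \<subseteq> K" by (meson ex_in_conv mem_interior_cball)
  have "bounded ((\<lambda>x. o' - x) ` K)"
    by (intro compact_imp_bounded compact_continuous_image cK continuous_intros)
  then obtain D where D: "0 < D" "\<And>x. x \<in> K \<Longrightarrow> norm (o' - x) \<le> D"
    by (auto simp: bounded_pos)
  \<comment> \<open>The bound \<open>1/2\<close> keeps the supporting lines at slope at most 1;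
    \<open>r / (2 * D)\<close> keeps the tilt small against the disc.\<close>
  define \<epsilon> where "\<epsilon> = min (1/2) (r / (2 * D))"
  have "\<epsilon> * D \<le> (r / (2 * D)) * D" using D(1) by (intro mult_right_mono) (auto simp: \<epsilon>_def)
  also have "\<dots> < r" using D(1) ball(1) by simp
  finally have \<epsilon>: "0 < \<epsilon>" "\<epsilon> \<le> 1/2" "\<epsilon> * D < r" using D(1) ball(1) by (auto simp: \<epsilon>_def)
  obtain \<delta> where \<delta>: "\<delta> > 0" "\<And>x y n m. x \<in> K \<Longrightarrow> y \<in> K \<Longrightarrow> norm n = 1 \<Longrightarrow> norm m = 1 \<Longrightarrow>
      (\<And>w. w \<in> K \<Longrightarrow> n \<bullet> w \<le> n \<bullet> x) \<Longrightarrow> (\<And>w. w \<in> K \<Longrightarrow> m \<bullet> w \<le> m \<bullet> y) \<Longrightarrow>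
      dist x y < \<delta> \<Longrightarrow> dist n m < \<epsilon>"
    using unit_normal_uniformly_continuous[OF K \<epsilon>(1)] by metis
  \<comment> \<open>\<open>2 * r\<close> makes the diameter of the disc at least as long as
    \<open>cd\<close>. Halving \<open>\<delta>\<close> turns the bound
    \<open>dist x y \<le> dist c d\<close> into the strict one required for the normals.\<close>
  define \<tau> where "\<tau> = min (2 * r) (\<delta> / 2)"
  have "\<exists>w\<in>{a, b}. w - v \<in> K \<and> dist w c < dist c d"
    if ab: "a \<in> K" "b \<in> K" and cd: "c \<notin> K" "d \<notin> K" and v: "c - v \<in> K" "d - v \<in> K"
      and g: "g \<in> open_segment a b" "g \<in> open_segment c d" and nc: "\<not> collinear {a, b, c, d}"
      and short: "dist c d \<le> \<tau>" for a b c d g v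
  proof -
    have normals: "dist n m < \<epsilon>" if "x \<in> K" "y \<in> K" "norm n = 1" "norm m = 1"
      "\<And>w. w \<in> K \<Longrightarrow> n \<bullet> w \<le> n \<bullet> x" "\<And>w. w \<in> K \<Longrightarrow> m \<bullet> w \<le> m \<bullet> y" "dist x y \<le> dist c d" for x y n m
      using \<delta>(2)[OF that(1-6)] that(7) short \<delta>(1) by (auto simp: \<tau>_def)
    have "g \<in> K" using g(1) ab cK(2) by (meson convex_contains_open_segment subsetD)
    have "d - c \<noteq> 0" using g(2) by auto
    then obtain f0 where f0: "norm f0 = 1" "f0 \<bullet> (d - c) = 0" using exists_unit_normal_to by blast
    define f where "f = (if f0 \<bullet> (o' - c) \<le> 0 then f0 else - f0)"
    have f: "norm f = 1" "f \<bullet> (d - c) = 0" "f \<bullet> (o' - c) \<le> 0" using f0 by (auto simp: f_def)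
    obtain s where s: "0 < s" "s < 1" "g = (1 - s) *\<^sub>R a + s *\<^sub>R b"
      using g(1) by (auto simp: in_segment)
    obtain t where t: "g = (1 - t) *\<^sub>R c + t *\<^sub>R d" using g(2) by (auto simp: in_segment)
    have gf: "g - c = t *\<^sub>R (d - c)" using t by (simp add: algebra_simps)
    have "g - c = (1 - s) *\<^sub>R (a - c) + s *\<^sub>R (b - c)" using s(3) by (simp add: algebra_simps)
    then have "(1 - s) * (f \<bullet> (a - c)) + s * (f \<bullet> (b - c)) = f \<bullet> (g - c)" by (simp add: inner_simps)
    then have sum0: "(1 - s) * (f \<bullet> (a - c)) + s * (f \<bullet> (b - c)) = 0" using gf f(2) by simp
    \<comment> \<open>The heights of \<open>a\<close> and \<open>b\<close> over the line
      \<open>cd\<close> have a weighted mean 0 with positive weights. If neither is positive, both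
      vanish and the four points are collinear.\<close>
    have "0 < f \<bullet> (a - c) \<or> 0 < f \<bullet> (b - c)"
    proof (rule ccontr)
      assume "\<not> ?thesis"
      then have "f \<bullet> (a - c) \<le> 0" "f \<bullet> (b - c) \<le> 0" by auto
      then have "(1 - s) * (f \<bullet> (a - c)) \<le> 0" "s * (f \<bullet> (b - c)) \<le> 0"
        using s(1,2) by (auto intro: mult_nonneg_nonpos)
      then have "(1 - s) * (f \<bullet> (a - c)) = 0" "s * (f \<bullet> (b - c)) = 0" using sum0 by linarith+
      then have 0: "f \<bullet> (a - c) = 0" "f \<bullet> (b - c) = 0" using s(1,2) by auto
      define e where "e = (1 / norm (d - c)) *\<^sub>R (d - c)"
      have e: "norm e = 1" "e \<bullet> f = 0" using \<open>d - c \<noteq> 0\<close> f(2) by (auto simp: e_def inner_commute)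
      have "\<exists>k. w = c + k *\<^sub>R e" if "f \<bullet> (w - c) = 0" for w
        using orthonormal_expansion(1)[OF e(1) f(1) e(2), of "w - c"] that
        by (intro exI[of _ "(w - c) \<bullet> e"]) (simp add: inner_commute algebra_simps)
      then have "collinear {a, b, c, d}"
        unfolding collinear_alt using 0 f(2) by (intro exI[of _ c] exI[of _ e]) auto
      with nc show False by blast
    qed
    then obtain w where w: "w \<in> {a, b}" "w \<in> K" "0 < f \<bullet> (w - c)" using ab by blast
    have "dist c d \<le> 2 * r" using short by (simp add: \<tau>_def)
    then have "w - v \<in> K"
      using cap_point_mem_translate[OF cK(2) ball(2,1) _ cd \<open>g \<in> K\<close> g(2) w(2) f w(3) v] by blast
    moreover have "dist w c < dist c d"
      by (rule cap_point_close[OF cK ball(2,1) D(2) \<epsilon> normals cd \<open>g \<in> K\<close> g(2) w(2) f w(3)])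
    ultimately show ?thesis using w(1) by blast
  qed
  moreover have "0 < \<tau>" using ball(1) \<delta>(1) by (simp add: \<tau>_def)
  ultimately show ?thesis by (intro exI[of _ \<tau>]) blast
qed

section \<open>Closest pairs that cross\<close>

lemma closest_pair_commute: "closest_pair A a b \<longleftrightarrow> closest_pair A b a"
  by (auto simp: closest_pair_def dist_commute)

text \<open>The side \<open>ad\<close> joins points of \<open>B\<close> and the side
  \<open>cb\<close> joins points of \<open>A\<close>, so together they are at least as long as the
  diagonals \<open>cd\<close> and \<open>ab\<close>. The strict triangle inequalities at
  \<open>g\<close> say the opposite.\<close>

lemma crossing_closest_pairs_not_both:
  fixes a :: "real^2"
  assumes ab: "closest_pair A a b" and cd: "closest_pair B c d"
    and g: "g \<in> open_segment a b" "g \<in> open_segment c d" and nc: "\<not> collinear {a, b, c, d}"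
    and "a \<in> B" "c \<in> A"
  shows False
proof -
  have nc': "\<not> collinear {c, d, a, b}" using nc by (simp add: insert_commute)
  note ad = crossing_side_less[OF g nc] and cb = crossing_side_less[OF g(2,1) nc']
  have "dist c d \<le> dist a d" using cd \<open>a \<in> B\<close> ad(1) by (auto simp: closest_pair_def)
  moreover have "dist a b \<le> dist c b" using ab \<open>c \<in> A\<close> cb(1) by (auto simp: closest_pair_def)
  moreover have "dist a b = dist a g + dist g b" "dist c d = dist c g + dist g d"
    using g by (auto simp: between[symmetric] between_mem_segment open_segment_def)
  ultimately show False using ad(2) cb(2) by linarith
qed

theorem theorem3p2:
  fixes \<Gamma> :: "(real^2) set"
  assumes "smooth_convex_body \<Gamma>"
  shows "\<exists>\<tau>::real. \<tau> > 0 \<and>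
    (\<forall>S :: (real^2) set. finite S \<longrightarrow> distinct_pairwise_distances S \<longrightarrow> no_three_collinear S \<longrightarrow>
      (\<forall>a b c d. (a, b) \<in> candidate_pairs S (translates \<Gamma>) \<longrightarrow>
                 (c, d) \<in> candidate_pairs S (translates \<Gamma>) \<longrightarrow>
                 dist a b \<le> \<tau> \<longrightarrow> dist c d \<le> \<tau> \<longrightarrow>
                 \<not> segments_cross a b c d))"
proof -
  obtain \<tau> where "0 < \<tau>" and out: "\<And>a b c d g v. \<lbrakk>a \<in> \<Gamma>; b \<in> \<Gamma>; c \<notin> \<Gamma>; d \<notin> \<Gamma>; c - v \<in> \<Gamma>; d - v \<in> \<Gamma>;
    g \<in> open_segment a b; g \<in> open_segment c d; \<not> collinear {a, b, c, d}; dist c d \<le> \<tau>\<rbrakk>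
    \<Longrightarrow> \<exists>w\<in>{a, b}. w - v \<in> \<Gamma> \<and> dist w c < dist c d"
    using short_crossing_outside[OF assms] by metis
  have mem: "x \<in> (+) p ` \<Gamma> \<longleftrightarrow> x - p \<in> \<Gamma>" for x p :: "real^2"
    by (metis (no_types, opaque_lifting) add_diff_cancel_left' diff_add_cancel add.commute image_iff)
  \<comment> \<open>Translating by \<open>- p\<close> turns the first range into
    \<open>\<Gamma>\<close> and the second into its translate by \<open>v = q - p\<close>.\<close>
  have enter: "c \<in> (+) p ` \<Gamma> \<or> d \<in> (+) p ` \<Gamma>"
    if ab: "closest_pair (S \<inter> (+) p ` \<Gamma>) a b" and cd: "closest_pair (S \<inter> (+) q ` \<Gamma>) c d"
      and g: "g \<in> open_segment a b" "g \<in> open_segment c d" and nc: "\<not> collinear {a, b, c, d}"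
      and short: "dist c d \<le> \<tau>" for S p q a b c d g
  proof (rule ccontr)
    assume "\<not> ?thesis"
    then have cd': "c - p \<notin> \<Gamma>" "d - p \<notin> \<Gamma>" by (auto simp: mem)
    have S: "a \<in> S" "b \<in> S" "c \<in> S" "d \<in> S" "a - p \<in> \<Gamma>" "b - p \<in> \<Gamma>"
      "c - p - (q - p) \<in> \<Gamma>" "d - p - (q - p) \<in> \<Gamma>"
      using ab cd by (auto simp: closest_pair_def mem)
    have seg: "g - p \<in> open_segment (x - p) (y - p)" if "g \<in> open_segment x y" for x y
      using that open_segment_translation_eq[of "- p" g x y] by (simp add: add.commute)
    have nc': "\<not> collinear {a - p, b - p, c - p, d - p}"
      using nc by (simp add: collinear_def)
    have "\<exists>w\<in>{a, b}. w - q \<in> \<Gamma> \<and> dist w c < dist c d"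
      using out[OF S(5,6) cd' S(7,8) seg[OF g(1)] seg[OF g(2)] nc'] short
      by (auto simp: dist_norm)
    then obtain w where "w \<in> {a, b}" "w - q \<in> \<Gamma>" "dist w c < dist c d" by blast
    \<comment> \<open>\<open>w\<close> differs from \<open>c\<close> because \<open>w\<close> lies
      in the translate by \<open>p\<close> and \<open>c\<close> does not. So \<open>w\<close> and
      \<open>c\<close> form a shorter pair in the range of \<open>cd\<close>.\<close>
    then have "w \<in> S \<inter> (+) q ` \<Gamma>" "w \<noteq> c" "dist w c < dist c d"
      using S cd' by (auto simp: mem)
    then show False using cd unfolding closest_pair_def by (meson not_le)
  qed
  have "\<not> segments_cross a b c d"
    if cand: "(a, b) \<in> candidate_pairs S (translates \<Gamma>)" "(c, d) \<in> candidate_pairs S (translates \<Gamma>)"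
      and short: "dist a b \<le> \<tau>" "dist c d \<le> \<tau>" for S a b c d
  proof
    assume "segments_cross a b c d"
    then obtain g where g: "g \<in> open_segment a b" "g \<in> open_segment c d"
      and nc: "\<not> collinear {a, b, c, d}" by (auto simp: segments_cross_def)
    obtain p q where ab: "closest_pair (S \<inter> (+) p ` \<Gamma>) a b" and cd: "closest_pair (S \<inter> (+) q ` \<Gamma>) c d"
      using cand by (auto simp: candidate_pairs_def translates_def)
    have nc': "\<not> collinear {c, d, a, b}" using nc by (simp add: insert_commute)
    define A where "A = S \<inter> (+) p ` \<Gamma>"
    define B where "B = S \<inter> (+) q ` \<Gamma>"
    have S: "{a, b, c, d} \<subseteq> S" using ab cd by (auto simp: closest_pair_def)
    have "c \<in> A \<or> d \<in> A" using enter[OF ab cd g nc short(2)] S by (auto simp: A_def)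
    moreover have "a \<in> B \<or> b \<in> B" using enter[OF cd ab g(2,1) nc' short(1)] S by (auto simp: B_def)
    \<comment> \<open>\<open>x\<close> is the end of \<open>ab\<close> in \<open>B\<close> and
      \<open>y\<close> the end of \<open>cd\<close> in \<open>A\<close>, with \<open>x'\<close> and
      \<open>y'\<close> the other ends. This covers all four choices by relabelling.\<close>
    moreover have no: False if "x \<in> B" "y \<in> A" "{x, x'} = {a, b}" "{y, y'} = {c, d}" for x x' y y'
    proof (rule crossing_closest_pairs_not_both)
      show "closest_pair A x x'" "closest_pair B y y'"
        using ab cd that closest_pair_commute by (auto simp: A_def B_def doubleton_eq_iff)
      show "g \<in> open_segment x x'" "g \<in> open_segment y y'"
        using g that open_segment_commute by (auto simp: doubleton_eq_iff)
      have "{x, x', y, y'} = {a, b, c, d}" using that by blast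
      then show "\<not> collinear {x, x', y, y'}" using nc by simp
    qed (use that in auto)
    moreover have "{b, a} = {a, b}" "{d, c} = {c, d}" by auto
    ultimately show False using no[OF _ _ refl refl] no[OF _ _ refl] no[OF _ _ _ refl] no by blast
  qed
  then show ?thesis using \<open>0 < \<tau>\<close> by (intro exI[of _ \<tau>]) blast
qed

end
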